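(* For each integer $\delta \geq 2$, there exist infinitely many (pairwise non-isomorphic) graphs $G$ with minimum degree $\delta$ such that, writing $n$ for the order of $G$, $rad_p(G) = n - \delta - 1$.
   Context: All graphs are finite, simple, undirected and non-empty. For a graph $G$ and $S \subseteq V(G)$, define $P^1_G(S) = N[S]$ (the closed neighbourhood of $S$), and for $i \geq 1$ let $V^i = \{v \in P^i_G(S) : |N[v] \setminus P^i_G(S)| \leq 1\}$ and $P^{i+1}_G(S) = P^i_G(S) \cup N[V^i]$. The set $S$ is a power dominating set (PDS) of $G$ if $P^i_G(S) = V(G)$ for some $i \ge 1$. The power domination number $\gamma_p(G)$ is the minimum cardinality of a PDS of $G$. For a PDS $S$, $rad_p(G,S) = \min\{i \geq 1 : P^i_G(S) = V(G)\}$. The propagation radius of $G$ is $rad_p(G) = \min\{rad_p(G,S) : S \text{ is a PDS of } G \text{ with } |S| = \gamma_p(G)\}$. *)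

theory Defs
  imports "Graph_Theory.Graph_Theory"
begin

text \<open>
  A finite simple undirected graph is a \<^locale>\<open>pair_graph\<close>: a symmetric loop-free digraph
  with finite vertex set, whose arcs are pairs of vertices. The locale admits the graph
  without vertices, so non-emptiness is a separate hypothesis where it matters. By symmetry
  the degree of a vertex is its \<^const>\<open>out_degree\<close>.
\<close>

definition min_degree :: "'a pair_pre_digraph \<Rightarrow> nat" where
  "min_degree G = Min (out_degree (with_proj G) ` pverts G)"

definition closed_nbhd :: "'a pair_pre_digraph \<Rightarrow> 'a set \<Rightarrow> 'a set" where
  "closed_nbhd G S = S \<union> {v. \<exists>u\<in>S. (u, v) \<in> parcs G}"

definition pd_step :: "'a pair_pre_digraph \<Rightarrow> 'a set \<Rightarrow> 'a set" where
  "pd_step G P = P \<union> closed_nbhd G {v \<in> P. card (closed_nbhd G {v} - P) \<le> 1}"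

text \<open>
  \<open>pd_set G S i\<close> is $P^i_G(S)$. It is meaningful only for \<open>i \<ge> 1\<close>; the definitions below
  never use \<open>i = 0\<close>.
\<close>

definition pd_set :: "'a pair_pre_digraph \<Rightarrow> 'a set \<Rightarrow> nat \<Rightarrow> 'a set" where
  "pd_set G S i = (pd_step G ^^ (i - 1)) (closed_nbhd G S)"

definition power_dominating :: "'a pair_pre_digraph \<Rightarrow> 'a set \<Rightarrow> bool" where
  "power_dominating G S \<longleftrightarrow> S \<subseteq> pverts G \<and> (\<exists>i\<ge>1. pd_set G S i = pverts G)"

definition power_domination_number :: "'a pair_pre_digraph \<Rightarrow> nat" where
  "power_domination_number G = (LEAST k. \<exists>S. power_dominating G S \<and> card S = k)"

definition rad_p_set :: "'a pair_pre_digraph \<Rightarrow> 'a set \<Rightarrow> nat" where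
  "rad_p_set G S = (LEAST i. i \<ge> 1 \<and> pd_set G S i = pverts G)"

definition rad_p :: "'a pair_pre_digraph \<Rightarrow> nat" where
  "rad_p G = (LEAST r. \<exists>S. power_dominating G S \<and> card S = power_domination_number G
                          \<and> rad_p_set G S = r)"

end

theory Submission
  imports Defs
begin

text \<open>
  A singleton whose closed neighbourhood has \<open>\<delta> + 2\<close> vertices and after which every step adds
  exactly one vertex needs \<open>n - \<delta> - 1\<close> steps. Long strips, in which each late vertex is adjacent
  to its \<open>\<delta>\<close> predecessors, propagate this slowly from one end, but a start in the middle would
  spread both ways. The head of the strip is designed to prevent that: every vertex not in it,
  and all but two in it, misses the closed neighbourhood of some fort, a set that is
  never entered because no outside vertex has exactly one neighbour in it.
\<close>

section \<open>Forts and steps that observe a single vertex\<close>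

lemma closed_nbhd_singleton: "closed_nbhd G {v} = insert v {w. (v, w) \<in> parcs G}"
  by (auto simp: closed_nbhd_def)

lemma pd_set_1: "pd_set G S (Suc 0) = closed_nbhd G S"
  by (simp add: pd_set_def)

lemma pd_set_Suc: "i \<ge> 1 \<Longrightarrow> pd_set G S (Suc i) = pd_step G (pd_set G S i)"
  by (cases i) (simp_all add: pd_set_def)

lemma finite_closed_nbhd: "finite (parcs G) \<Longrightarrow> finite (closed_nbhd G {v})"
  by (rule finite_subset[of _ "insert v (snd ` parcs G)"])
     (force simp: closed_nbhd_singleton)+

lemma card_nbhd_gt_1:
  assumes "finite (parcs G)" "(v, w) \<in> parcs G" "(v, w') \<in> parcs G" "w \<noteq> w'"
    and "w \<notin> P" "w' \<notin> P"
  shows "\<not> card (closed_nbhd G {v} - P) \<le> 1"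
proof -
  have "card {w, w'} \<le> card (closed_nbhd G {v} - P)"
    using assms by (intro card_mono finite_Diff finite_closed_nbhd) (auto simp: closed_nbhd_singleton)
  then show ?thesis using assms(4) by simp
qed

text \<open>Asking for a second neighbour instead of counting lets \<open>F\<close> be infinite and
  contain non-vertices, so that tails such as \<open>{2 * d..}\<close> need no upper end.\<close>

definition fort :: "'a pair_pre_digraph \<Rightarrow> 'a set \<Rightarrow> bool" where
  "fort G F \<longleftrightarrow> (\<forall>u w. u \<notin> F \<and> w \<in> F \<and> (u, w) \<in> parcs G \<longrightarrow>
     (\<exists>w'\<in>F. w' \<noteq> w \<and> (u, w') \<in> parcs G))"

lemma fortI:
  assumes "\<And>u w. u \<notin> F \<Longrightarrow> w \<in> F \<Longrightarrow> (u, w) \<in> parcs G \<Longrightarrow>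
     \<exists>x\<in>F. \<exists>y\<in>F. x \<noteq> y \<and> (u, x) \<in> parcs G \<and> (u, y) \<in> parcs G"
  shows "fort G F"
  unfolding fort_def using assms by metis

text \<open>An observed vertex with a neighbour in \<open>F\<close> has two there, both still
  unobserved, so it cannot propagate.\<close>

lemma pd_step_fort:
  assumes "finite (parcs G)" "fort G F" "P \<inter> F = {}"
  shows "pd_step G P \<inter> F = {}"
proof (rule ccontr)
  assume "pd_step G P \<inter> F \<noteq> {}"
  then obtain w where w: "w \<in> F" "w \<in> pd_step G P" by blast
  with assms(3) obtain v where v: "v \<in> P" "card (closed_nbhd G {v} - P) \<le> 1" "(v, w) \<in> parcs G"
    by (auto simp: pd_step_def closed_nbhd_def)
  with w assms obtain w' where "w' \<in> F" "w' \<noteq> w" "(v, w') \<in> parcs G"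
    unfolding fort_def by blast
  with card_nbhd_gt_1[of G v w w' P] v w assms show False by blast
qed

text \<open>The first step observes all neighbours unconditionally and could enter a fort; hence the
  condition is on \<open>closed_nbhd G S\<close> and not on \<open>S\<close>.\<close>

lemma not_power_dominating_fort:
  assumes "finite (parcs G)" "fort G F" "closed_nbhd G S \<inter> F = {}" "x \<in> F" "x \<in> pverts G"
  shows "\<not> power_dominating G S"
proof -
  have "pd_set G S i \<inter> F = {}" if "i \<ge> 1" for i
    using that by (induction i rule: dec_induct)
      (simp_all add: assms pd_set_1 pd_set_Suc pd_step_fort)
  then show ?thesis
    using assms(4,5) by (auto simp: power_dominating_def)
qed

text \<open>Some observed vertex has \<open>w\<close> as its only unobserved neighbour and forces
  it. An observed vertex adjacent to another unobserved one has a second unobserved neighbour,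
  possibly \<open>w\<close> itself, and stays inactive.\<close>

lemma pd_step_insert:
  assumes "finite (parcs G)" "w \<notin> P"
    and "\<exists>a\<in>P. \<forall>b. b \<notin> P \<longrightarrow> (a, b) \<in> parcs G \<longleftrightarrow> b = w"
    and "\<And>a b. a \<in> P \<Longrightarrow> b \<notin> P \<Longrightarrow> b \<noteq> w \<Longrightarrow> (a, b) \<in> parcs G \<Longrightarrow>
           \<exists>b'. b' \<notin> P \<and> b' \<noteq> b \<and> (a, b') \<in> parcs G"
  shows "pd_step G P = insert w P"
proof
  from assms(3) obtain a where a: "a \<in> P" "\<And>b. b \<notin> P \<Longrightarrow> (a, b) \<in> parcs G \<longleftrightarrow> b = w"
    by blast
  then have "closed_nbhd G {a} - P = {w}"
    using assms(2) by (auto simp: closed_nbhd_singleton)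
  then show "insert w P \<subseteq> pd_step G P"
    using a assms(2) by (auto simp: pd_step_def closed_nbhd_def)
  show "pd_step G P \<subseteq> insert w P"
  proof (rule ccontr)
    assume "\<not> pd_step G P \<subseteq> insert w P"
    then obtain b where b: "b \<in> pd_step G P" "b \<notin> P" "b \<noteq> w" by blast
    then obtain a where v: "a \<in> P" "card (closed_nbhd G {a} - P) \<le> 1" "(a, b) \<in> parcs G"
      by (auto simp: pd_step_def closed_nbhd_def)
    with assms(4) b obtain b' where "b' \<notin> P" "b' \<noteq> b" "(a, b') \<in> parcs G" by metis
    with card_nbhd_gt_1[of G a b b' P] v b assms(1) show False by blast
  qed
qed

section \<open>Propagation radius and minimum degree\<close>

lemma pd_set_empty: "i \<ge> 1 \<Longrightarrow> pd_set G {} i = {}"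
  by (induction i rule: dec_induct) (simp_all add: pd_set_1 pd_set_Suc pd_step_def closed_nbhd_def)

lemma rad_p_set_eqI:
  assumes "r \<ge> 1" "pd_set G S r = pverts G" "\<And>i. 1 \<le> i \<Longrightarrow> i < r \<Longrightarrow> pd_set G S i \<noteq> pverts G"
  shows "rad_p_set G S = r"
  unfolding rad_p_set_def using assms by (intro Least_equality) (auto intro: leI)

text \<open>The empty set never observes anything, so a power dominating singleton makes the power
  domination number 1. The minimum then ranges over singletons only, all of radius
  \<open>r\<close>.\<close>

lemma rad_p_eqI:
  assumes "finite (pverts G)" "pverts G \<noteq> {}" "power_dominating G {v}"
    and "\<And>w. power_dominating G {w} \<Longrightarrow> rad_p_set G {w} = r"
  shows "rad_p G = r"
proof -
  have "power_domination_number G = 1"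
    unfolding power_domination_number_def
  proof (rule Least_equality)
    show "\<exists>S. power_dominating G S \<and> card S = 1" using assms(3) by fastforce
  next
    fix k assume "\<exists>S. power_dominating G S \<and> card S = k"
    then obtain S where S: "power_dominating G S" "card S = k" by blast
    have "S \<noteq> {}"
      using S(1) pd_set_empty[of _ G] assms(2) by (auto simp: power_dominating_def)
    moreover have "finite S"
      using S(1) assms(1) finite_subset by (auto simp: power_dominating_def)
    ultimately show "1 \<le> k" using S(2) by (metis One_nat_def Suc_leI card_gt_0_iff)
  qed
  then show ?thesis
    unfolding rad_p_def using assms(3,4)
    by (intro Least_equality) (auto simp: card_1_singleton_iff)
qed

lemma out_degree_with_proj: "out_degree (with_proj G) v = card {w. (v, w) \<in> parcs G}"
proof -
  have "out_arcs (with_proj G) v = Pair v ` {w. (v, w) \<in> parcs G}"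
    by (auto simp: out_arcs_def)
  then show ?thesis
    by (simp add: out_degree_def card_image inj_on_def)
qed

lemma min_degree_eqI:
  assumes "finite (pverts G)" "finite (parcs G)"
    and "\<And>v. v \<in> pverts G \<Longrightarrow> \<exists>A. card A = d \<and> A \<subseteq> {w. (v, w) \<in> parcs G}"
    and "v \<in> pverts G" "card {w. (v, w) \<in> parcs G} = d"
  shows "min_degree G = d"
  unfolding min_degree_def
proof (rule Min_eqI)
  show "d \<in> out_degree (with_proj G) ` pverts G"
    using assms(4,5) by (auto simp: out_degree_with_proj)
  fix k assume "k \<in> out_degree (with_proj G) ` pverts G"
  then obtain u where u: "u \<in> pverts G" "k = card {w. (u, w) \<in> parcs G}"
    by (auto simp: out_degree_with_proj)
  have "finite {w. (u, w) \<in> parcs G}"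
    using finite_closed_nbhd[OF assms(2), of u] by (simp add: closed_nbhd_singleton)
  then show "d \<le> k" using assms(3)[OF u(1)] u(2) card_mono by blast
qed (use assms(1) in simp)

lemma digraph_iso_card_verts:
  assumes "digraph_iso G H"
  shows "card (verts G) = card (verts H)"
  using assms unfolding digraph_iso_def
  by (auto simp: verts_app_iso card_image pre_digraph.digraph_isomorphism_def)

section \<open>Graphs on initial segments of the naturals\<close>

text \<open>\<open>E\<close> is consulted only at pairs \<open>a < b\<close>, so every relation
  yields a symmetric loop-free graph.\<close>

definition nat_graph :: "nat \<Rightarrow> (nat \<Rightarrow> nat \<Rightarrow> bool) \<Rightarrow> nat pair_pre_digraph" where
  "nat_graph n E =
     \<lparr>pverts = {..<n}, parcs = {(a, b). a < n \<and> b < n \<and> (a < b \<and> E a b \<or> b < a \<and> E b a)}\<rparr>"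

lemma pverts_nat_graph [simp]: "pverts (nat_graph n E) = {..<n}"
  by (simp add: nat_graph_def)

lemma parcs_nat_graph:
  "(a, b) \<in> parcs (nat_graph n E) \<longleftrightarrow> a < n \<and> b < n \<and> (a < b \<and> E a b \<or> b < a \<and> E b a)"
  by (simp add: nat_graph_def)

lemma finite_parcs_nat_graph: "finite (parcs (nat_graph n E))"
  by (rule finite_subset[of _ "{..<n} \<times> {..<n}"]) (auto simp: nat_graph_def)

lemma pair_graph_nat_graph: "pair_graph (nat_graph n E)"
  by unfold_locales
     (auto simp: parcs_nat_graph finite_parcs_nat_graph symmetric_def sym_def
        arcs_ends_def arc_to_ends_def)

lemma pd_step_nat_graph_atMost:
  assumes "Suc m < n"
    and "\<exists>a\<le>m. \<forall>b>m. b < n \<longrightarrow> E a b \<longleftrightarrow> b = Suc m"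
    and "\<And>a b. a \<le> m \<Longrightarrow> Suc m < b \<Longrightarrow> b < n \<Longrightarrow> E a b \<Longrightarrow> \<exists>b'>m. b' < n \<and> b' \<noteq> b \<and> E a b'"
  shows "pd_step (nat_graph n E) {..m} = {..Suc m}"
proof -
  have "pd_step (nat_graph n E) {..m} = insert (Suc m) {..m}"
  proof (rule pd_step_insert)
    from assms(2) obtain a where a: "a \<le> m" "\<And>b. m < b \<Longrightarrow> b < n \<Longrightarrow> E a b \<longleftrightarrow> b = Suc m"
      by blast
    have "(a, b) \<in> parcs (nat_graph n E) \<longleftrightarrow> b = Suc m" if "b \<notin> {..m}" for b
    proof -
      have "(a, b) \<in> parcs (nat_graph n E) \<longleftrightarrow> b < n \<and> E a b"
        using that a(1) by (auto simp: parcs_nat_graph)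
      with that a(2)[of b] assms(1) show ?thesis by auto
    qed
    then show "\<exists>a\<in>{..m}. \<forall>b. b \<notin> {..m} \<longrightarrow> (a, b) \<in> parcs (nat_graph n E) \<longleftrightarrow> b = Suc m"
      using a(1) by blast
    fix a b assume ab: "a \<in> {..m}" "b \<notin> {..m}" "b \<noteq> Suc m" "(a, b) \<in> parcs (nat_graph n E)"
    then have "a \<le> m" "Suc m < b" "b < n" "E a b"
      by (auto simp: parcs_nat_graph)
    with assms(3) obtain b' where "m < b'" "b' < n" "b' \<noteq> b" "E a b'" by blast
    then show "\<exists>b'. b' \<notin> {..m} \<and> b' \<noteq> b \<and> (a, b') \<in> parcs (nat_graph n E)"
      using ab by (intro exI[of _ b']) (auto simp: parcs_nat_graph)
  qed (auto simp: finite_parcs_nat_graph)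
  then show ?thesis by (simp add: atMost_Suc)
qed

lemma pd_set_linear:
  assumes "r \<ge> 1" "pd_set G S r = {..d + r}"
    and "\<And>m. d + r \<le> m \<Longrightarrow> Suc m < n \<Longrightarrow> pd_step G {..m} = {..Suc m}"
    and "r \<le> i" "d + i < n"
  shows "pd_set G S i = {..d + i}"
  using assms(4,5)
proof (induction i rule: dec_induct)
  case (step i)
  then show ?case using assms(1,3) by (simp add: pd_set_Suc)
qed (use assms(2) in simp)

text \<open>From step \<open>r\<close> on, \<open>{..d + i}\<close> is observed, so the last vertex
  \<open>n - 1\<close> enters at \<open>i = n - d - 1\<close>. The parameter \<open>r\<close> leaves
  room for a start whose earlier steps do not give initial segments.\<close>

lemma rad_p_set_linear:
  fixes S :: "nat set"
  assumes "r \<ge> 1" "pd_set G S r = {..d + r}"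
    and "\<And>m. d + r \<le> m \<Longrightarrow> Suc m < n \<Longrightarrow> pd_step G {..m} = {..Suc m}"
    and "d + r < n" "pverts G = {..<n}" "\<And>i. 1 \<le> i \<Longrightarrow> i < r \<Longrightarrow> pd_set G S i \<noteq> pverts G"
  shows "rad_p_set G S = n - d - 1" "\<exists>i\<ge>1. pd_set G S i = pverts G"
proof -
  have lin: "pd_set G S i = {..d + i}" if "r \<le> i" "d + i < n" for i
    using pd_set_linear[OF assms(1-3) that] .
  have n: "{..d + (n - d - 1)} = {..<n}" using assms(4) by auto
  have last: "pd_set G S (n - d - 1) = pverts G"
    using lin[of "n - d - 1"] assms(4) unfolding n assms(5) by simp
  then show "\<exists>i\<ge>1. pd_set G S i = pverts G"
    using assms(1,4) by (intro exI[of _ "n - d - 1"]) auto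
  show "rad_p_set G S = n - d - 1"
  proof (rule rad_p_set_eqI)
    fix i assume i: "1 \<le> i" "i < n - d - 1"
    show "pd_set G S i \<noteq> pverts G"
    proof (cases "i < r")
      case False
      then have "pd_set G S i = {..d + i}" "n - 1 \<notin> {..d + i}" "n - 1 \<in> {..<n}"
        using lin[of i] i by auto
      then show ?thesis using assms(5) by metis
    qed (use assms(6) i in blast)
  qed (use assms(1,4) last in auto)
qed

section \<open>Minimum degree at least three\<close>

text \<open>
  The true twins \<open>0\<close> and \<open>1\<close> see exactly the vertices \<open>2, \<dots>, d + 1\<close>. These form a clique on
  \<open>2, \<dots>, d - 1\<close> (needed only for the degree of \<open>2\<close>, \<open>3\<close>, \<open>\<dots>\<close>) and two vertices isolated from the
  others, so that a start at any of them leaves two neighbours of each twin unobserved.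
\<close>

definition twin_strip_edge :: "nat \<Rightarrow> nat \<Rightarrow> nat \<Rightarrow> bool" where
  "twin_strip_edge d a b \<longleftrightarrow>
     a < 2 \<and> b \<le> d + 1 \<or> 2 \<le> a \<and> b < d \<or> 2 \<le> a \<and> d + 2 \<le> b \<and> b \<le> a + d"

text \<open>The starts \<open>0\<close> and \<open>1\<close> observe \<open>{..d + 1}\<close> at
  once, then the strip fills vertex by vertex; four forts exclude all other starts. The bound on
  \<open>n\<close> ensures that the largest fort witness, \<open>2 * d + 3\<close>, is a
  vertex.\<close>

lemma rad_p_twin_strip:
  assumes d: "d \<ge> 3" and n: "n \<ge> 2 * d + 4"
  shows "rad_p (nat_graph n (twin_strip_edge d)) = n - d - 1"
proof -
  define G where "G = nat_graph n (twin_strip_edge d)"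
  note arc = parcs_nat_graph[of _ _ n "twin_strip_edge d", folded G_def] twin_strip_edge_def
  have fin: "finite (parcs G)" and V: "pverts G = {..<n}"
    by (simp_all add: G_def finite_parcs_nat_graph)
  have step: "pd_step G {..m} = {..Suc m}" if "d + 1 \<le> m" "Suc m < n" for m
    unfolding G_def
  proof (rule pd_step_nat_graph_atMost)
    \<comment> \<open>The witness \<open>Suc m - d\<close> is at least 2, and its last neighbour is
      \<open>Suc m\<close>.\<close>
    show "\<exists>a\<le>m. \<forall>b>m. b < n \<longrightarrow> twin_strip_edge d a b \<longleftrightarrow> b = Suc m"
      using that d by (intro exI[of _ "Suc m - d"]) (auto simp: twin_strip_edge_def)
    fix a b assume "a \<le> m" "Suc m < b" "b < n" "twin_strip_edge d a b"
    then show "\<exists>b'>m. b' < n \<and> b' \<noteq> b \<and> twin_strip_edge d a b'"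
      using that by (intro exI[of _ "Suc m"]) (auto simp: twin_strip_edge_def)
  qed fact
  have start: "pd_set G {v} 1 = {..d + 1}" if "v < 2" for v
    using that d n by (auto simp: pd_set_1 closed_nbhd_singleton arc)
  have rad: "rad_p_set G {v} = n - d - 1" "\<exists>i\<ge>1. pd_set G {v} i = pverts G" if "v < 2" for v
    using rad_p_set_linear[OF _ start[OF that] step, of n] V n by auto
  \<comment> \<open>Against the starts \<open>2, ..., d - 1\<close>: together their closed
    neighbourhoods cover all vertices except these.\<close>
  have fort1: "fort G ({d, d + 1} \<union> {2 * d..})"
  proof (rule fortI)
    fix u w assume u: "u \<notin> {d, d + 1} \<union> {2 * d..}" "w \<in> {d, d + 1} \<union> {2 * d..}" "(u, w) \<in> parcs G"
    then have "(u, d) \<in> parcs G \<and> (u, d + 1) \<in> parcs G"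
      using d n by (auto simp: arc)
    then show "\<exists>x\<in>{d, d + 1} \<union> {2 * d..}. \<exists>y\<in>{d, d + 1} \<union> {2 * d..}.
        x \<noteq> y \<and> (u, x) \<in> parcs G \<and> (u, y) \<in> parcs G"
      by (intro bexI[of _ d] bexI[of _ "d + 1"]) auto
  qed
  \<comment> \<open>Against the start \<open>d\<close>: the complement of its closed neighbourhood.
    The twins have two neighbours in it because \<open>d \<ge> 3\<close>.\<close>
  have fort2: "fort G ({2..<d} \<union> {d + 1} \<union> {2 * d + 1..})" (is "fort G ?F")
  proof (rule fortI)
    fix u w assume u: "u \<notin> ?F" "w \<in> ?F" "(u, w) \<in> parcs G"
    have "u \<noteq> d" using u d by (auto simp: arc)
    with u(1) consider "u < 2" | "d + 2 \<le> u" "u < 2 * d" | "u = 2 * d" by fastforce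
    then show "\<exists>x\<in>?F. \<exists>y\<in>?F. x \<noteq> y \<and> (u, x) \<in> parcs G \<and> (u, y) \<in> parcs G"
    proof cases
      case 1
      then show ?thesis using d n by (intro bexI[of _ "d - 1"] bexI[of _ "d + 1"]) (auto simp: arc)
    next
      case 2
      then show ?thesis using d n by (intro bexI[of _ "d - 1"] bexI[of _ "d + 1"]) (auto simp: arc)
    next
      case 3
      then show ?thesis using d n by (intro bexI[of _ "d + 1"] bexI[of _ "2 * d + 1"]) (auto simp: arc)
    qed
  qed
  \<comment> \<open>Against the start \<open>d + 1\<close>: again the complement of its closed
    neighbourhood.\<close>
  have fort3: "fort G ({2..d} \<union> {2 * d + 2..})" (is "fort G ?F")
  proof (rule fortI)
    fix u w assume u: "u \<notin> ?F" "w \<in> ?F" "(u, w) \<in> parcs G"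
    have "u \<noteq> d + 1" using u d by (auto simp: arc)
    \<comment> \<open>The vertex \<open>2 * d\<close> is adjacent to \<open>d\<close> but no longer
      to \<open>d - 1\<close>, and \<open>2 * d + 1\<close> to neither; their missing witnesses come
      from the tail of the fort.\<close>
    with u(1) consider "u < 2" | "d + 2 \<le> u" "u < 2 * d" | "u = 2 * d" | "u = 2 * d + 1"
      by fastforce
    then show "\<exists>x\<in>?F. \<exists>y\<in>?F. x \<noteq> y \<and> (u, x) \<in> parcs G \<and> (u, y) \<in> parcs G"
    proof cases
      case 1
      then show ?thesis using d n by (intro bexI[of _ "d - 1"] bexI[of _ "d"]) (auto simp: arc)
    next
      case 2
      then show ?thesis using d n by (intro bexI[of _ "d - 1"] bexI[of _ "d"]) (auto simp: arc)
    next
      case 3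
      then show ?thesis using d n by (intro bexI[of _ "d"] bexI[of _ "2 * d + 2"]) (auto simp: arc)
    next
      case 4
      then show ?thesis using d n by (intro bexI[of _ "2 * d + 2"] bexI[of _ "2 * d + 3"]) (auto simp: arc)
    qed
  qed
  \<comment> \<open>Outside vertices see both twins or neither, and those from \<open>d + 2\<close>
    on see neither.\<close>
  have fort4: "fort G {0, 1}"
    using d n by (intro fortI) (auto simp: arc)
  have pd: "w < 2" if w: "power_dominating G {w}" for w
  proof (rule ccontr)
    assume "\<not> w < 2"
    then consider "2 \<le> w" "w < d" | "w = d" | "w = d + 1" | "d + 2 \<le> w" by linarith
    then show False
    proof cases
      case 1
      show False
        by (rule notE[OF not_power_dominating_fort[OF fin fort1, of _ d] w])
           (use 1 d n in \<open>auto simp: closed_nbhd_singleton arc V\<close>)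
    next
      case 2
      show False
        by (rule notE[OF not_power_dominating_fort[OF fin fort2, of _ "d + 1"] w])
           (use 2 d n in \<open>auto simp: closed_nbhd_singleton arc V\<close>)
    next
      case 3
      show False
        by (rule notE[OF not_power_dominating_fort[OF fin fort3, of _ d] w])
           (use 3 d n in \<open>auto simp: closed_nbhd_singleton arc V\<close>)
    next
      case 4
      show False
        by (rule notE[OF not_power_dominating_fort[OF fin fort4, of _ 0] w])
           (use 4 d n in \<open>auto simp: closed_nbhd_singleton arc V\<close>)
    qed
  qed
  show ?thesis
    unfolding G_def[symmetric]
  proof (rule rad_p_eqI)
    show "power_dominating G {0}"
      using rad(2)[of 0] n V by (auto simp: power_dominating_def)
  qed (use V n pd rad(1) in \<open>auto simp: lessThan_empty_iff\<close>)
qed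

lemma min_degree_twin_strip:
  assumes d: "d \<ge> 3" and n: "n \<ge> 2 * d + 4"
  shows "min_degree (nat_graph n (twin_strip_edge d)) = d"
proof -
  define G where "G = nat_graph n (twin_strip_edge d)"
  note arc = parcs_nat_graph[of _ _ n "twin_strip_edge d", folded G_def] twin_strip_edge_def
  have fin: "finite (parcs G)" and V: "pverts G = {..<n}"
    by (simp_all add: G_def finite_parcs_nat_graph)
  have "min_degree G = d"
  proof (rule min_degree_eqI[where v = "n - 1"])
    have "{w. (n - 1, w) \<in> parcs G} = {n - 1 - d..<n - 1}"
      using d n by (auto simp: arc)
    then show "card {w. (n - 1, w) \<in> parcs G} = d" using n by simp
    fix v assume "v \<in> pverts G"
    then have "v < n" using V by simp
    consider "v < 2" | "2 \<le> v" "v < d" | "d \<le> v" "v < d + 2" | "d + 2 \<le> v" by linarith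
    then show "\<exists>A. card A = d \<and> A \<subseteq> {w. (v, w) \<in> parcs G}"
    proof cases
      case 1
      then show ?thesis using d n
        by (intro exI[of _ "{2..d + 1}"]) (auto simp: arc)
    next
      \<comment> \<open>The clique and the twins give \<open>d - 1\<close> neighbours;
        \<open>d + 2\<close> is in reach because \<open>v \<ge> 2\<close>.\<close>
      case 2
      then show ?thesis using d n
        by (intro exI[of _ "insert (d + 2) ({..<d} - {v})"]) (auto simp: arc)
    next
      case 3
      then show ?thesis using d n
        by (intro exI[of _ "insert 0 {d + 2..2 * d}"]) (auto simp: arc)
    next
      case 4
      then show ?thesis using d n \<open>v < n\<close>
        by (intro exI[of _ "{v - d..<v}"]) (auto simp: arc)
    qed
  qed (use V fin n in auto)
  then show ?thesis by (simp add: G_def)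
qed

section \<open>Minimum degree two\<close>

text \<open>
  The previous graph fails for \<open>d = 2\<close>: a start at \<open>2\<close> leaves only one neighbour of the twins. Here
  \<open>1\<close> and \<open>2\<close> are false twins with neighbours \<open>0\<close> and \<open>4\<close>, which are the two possible starts, and
  the strip is the square of the path \<open>3, 5, 6, 7, \<dots>\<close>, attached by the edges \<open>0 3\<close> and \<open>4 5\<close>.
\<close>

definition square_strip_edge :: "nat \<Rightarrow> nat \<Rightarrow> bool" where
  "square_strip_edge a b \<longleftrightarrow>
     a = 0 \<and> b \<le> 3 \<or> a \<in> {1, 2} \<and> b = 4 \<or> a = 3 \<and> b \<in> {5, 6} \<or> a = 4 \<and> b = 5 \<or>
     5 \<le> a \<and> b \<le> a + 2"

text \<open>The start \<open>0\<close> gives initial segments at once. The start \<open>4\<close>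
  observes \<open>1, 2, 4, 5\<close>, then \<open>0\<close>, then \<open>3\<close>, and reaches
  \<open>{..5}\<close> at step 3, exactly when the start \<open>0\<close> does; both radii
  agree.\<close>

lemma rad_p_square_strip:
  assumes n: "n \<ge> 8"
  shows "rad_p (nat_graph n square_strip_edge) = n - 3"
proof -
  define G where "G = nat_graph n square_strip_edge"
  note arc = parcs_nat_graph[of _ _ n square_strip_edge, folded G_def] square_strip_edge_def
  have fin: "finite (parcs G)" and V: "pverts G = {..<n}"
    by (simp_all add: G_def finite_parcs_nat_graph)
  have step: "pd_step G {..m} = {..Suc m}" if "3 \<le> m" "Suc m < n" for m
    unfolding G_def
  proof (rule pd_step_nat_graph_atMost)
    consider "m = 3" | "m = 4" | "m = 5" | "6 \<le> m" using \<open>3 \<le> m\<close> by linarith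
    then show "\<exists>a\<le>m. \<forall>b>m. b < n \<longrightarrow> square_strip_edge a b \<longleftrightarrow> b = Suc m"
    proof cases
      case 1
      then show ?thesis by (intro exI[of _ 1]) (auto simp: square_strip_edge_def)
    next
      case 2
      then show ?thesis by (intro exI[of _ 4]) (auto simp: square_strip_edge_def)
    next
      case 3
      then show ?thesis by (intro exI[of _ 3]) (auto simp: square_strip_edge_def)
    next
      case 4
      then show ?thesis by (intro exI[of _ "m - 1"]) (auto simp: square_strip_edge_def)
    qed
    \<comment> \<open>The strip passes from \<open>3\<close> directly to \<open>5\<close>, so for
      \<open>a = 3\<close> and \<open>b = 5\<close> the other unobserved neighbour is
      \<open>6\<close> and not \<open>b - 1 = 4\<close>.\<close>
    fix a b assume "a \<le> m" "Suc m < b" "b < n" "square_strip_edge a b"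
    then show "\<exists>b'>m. b' < n \<and> b' \<noteq> b \<and> square_strip_edge a b'"
      using \<open>3 \<le> m\<close> n
      by (intro exI[of _ "if a = 3 \<and> b = 5 then 6 else b - 1"]) (auto simp: square_strip_edge_def)
  qed fact
  have start0: "pd_set G {0} 1 = {..2 + 1}"
    using n by (auto simp: pd_set_1 closed_nbhd_singleton arc)
  have rad0: "rad_p_set G {0} = n - 2 - 1" "\<exists>i\<ge>1. pd_set G {0} i = pverts G"
    using rad_p_set_linear[OF _ start0 step, of n] V n by auto
  have P1: "pd_set G {4} 1 = {1, 2, 4, 5}"
    using n by (auto simp: pd_set_1 closed_nbhd_singleton arc)
  \<comment> \<open>The false twins force \<open>0\<close>, while \<open>5\<close> is blocked by its
    unobserved neighbours \<open>6\<close> and \<open>7\<close>; in the next step \<open>0\<close>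
    forces \<open>3\<close>.\<close>
  have "pd_step G {1, 2, 4, 5} = insert 0 {1, 2, 4, 5}"
  proof (rule pd_step_insert[OF fin])
    show "\<exists>a\<in>{1, 2, 4, 5}. \<forall>b. b \<notin> {1, 2, 4, 5} \<longrightarrow> (a, b) \<in> parcs G \<longleftrightarrow> b = 0"
      using n by (intro bexI[of _ 1]) (auto simp: arc)
    fix a b :: nat
    assume "a \<in> {1, 2, 4, 5}" "b \<notin> {1, 2, 4, 5}" "b \<noteq> 0" "(a, b) \<in> parcs G"
    then have "a = 5" using n by (auto simp: arc)
    then show "\<exists>b'. b' \<notin> {1, 2, 4, 5} \<and> b' \<noteq> b \<and> (a, b') \<in> parcs G"
      using n by (intro exI[of _ "if b = 6 then 7 else 6"]) (auto simp: arc)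
  qed simp
  then have P2: "pd_set G {4} 2 = {0, 1, 2, 4, 5}"
    using pd_set_Suc[of 1 G "{4}"] P1 by (simp add: numeral_2_eq_2)
  have "pd_step G {0, 1, 2, 4, 5} = insert 3 {0, 1, 2, 4, 5}"
  proof (rule pd_step_insert[OF fin])
    show "\<exists>a\<in>{0, 1, 2, 4, 5}. \<forall>b. b \<notin> {0, 1, 2, 4, 5} \<longrightarrow> (a, b) \<in> parcs G \<longleftrightarrow> b = 3"
      using n by (intro bexI[of _ 0]) (auto simp: arc)
    fix a b :: nat
    assume "a \<in> {0, 1, 2, 4, 5}" "b \<notin> {0, 1, 2, 4, 5}" "b \<noteq> 3" "(a, b) \<in> parcs G"
    then have "a = 5" using n by (auto simp: arc)
    then show "\<exists>b'. b' \<notin> {0, 1, 2, 4, 5} \<and> b' \<noteq> b \<and> (a, b') \<in> parcs G"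
      using n by (intro exI[of _ "if b = 6 then 7 else 6"]) (auto simp: arc)
  qed simp
  moreover have "insert 3 {0, 1, 2, 4, 5} = {..2 + 3 :: nat}"
    by (rule set_eqI, simp, arith)
  moreover have "pd_set G {4} 3 = pd_step G (pd_set G {4} 2)"
    using pd_set_Suc[of 2 G "{4}"] by simp
  ultimately have P3: "pd_set G {4} 3 = {..2 + 3}"
    using P2 by metis
  have rad4: "rad_p_set G {4} = n - 2 - 1"
  proof (rule rad_p_set_linear(1)[OF _ P3 step])
    fix i :: nat assume "1 \<le> i" "i < 3"
    then have "i = 1 \<or> i = 2" by auto
    then have "3 \<notin> pd_set G {4} i" using P1 P2 by auto
    moreover have "3 \<in> pverts G" using V n by simp
    ultimately show "pd_set G {4} i \<noteq> pverts G" by metis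
  qed (use V n in auto)
  \<comment> \<open>The next two forts are the complements of the closed neighbourhoods of
    \<open>1\<close> and \<open>2\<close>; the third is the pair of false twins.\<close>
  have fort1: "fort G ({2, 3} \<union> {5..})" (is "fort G ?F")
  proof (rule fortI)
    fix u w assume u: "u \<notin> ?F" "w \<in> ?F" "(u, w) \<in> parcs G"
    have "u \<noteq> 1" using u(2,3) by (auto simp: arc)
    with u(1) consider "u = 0" | "u = 4" by fastforce
    then show "\<exists>x\<in>?F. \<exists>y\<in>?F. x \<noteq> y \<and> (u, x) \<in> parcs G \<and> (u, y) \<in> parcs G"
    proof cases
      case 1
      then show ?thesis using n by (intro bexI[of _ 2] bexI[of _ 3]) (auto simp: arc)
    next
      case 2
      then show ?thesis using n by (intro bexI[of _ 2] bexI[of _ 5]) (auto simp: arc)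
    qed
  qed
  have fort2: "fort G ({1, 3} \<union> {5..})" (is "fort G ?F")
  proof (rule fortI)
    fix u w assume u: "u \<notin> ?F" "w \<in> ?F" "(u, w) \<in> parcs G"
    have "u \<noteq> 2" using u(2,3) by (auto simp: arc)
    with u(1) consider "u = 0" | "u = 4" by fastforce
    then show "\<exists>x\<in>?F. \<exists>y\<in>?F. x \<noteq> y \<and> (u, x) \<in> parcs G \<and> (u, y) \<in> parcs G"
    proof cases
      case 1
      then show ?thesis using n by (intro bexI[of _ 1] bexI[of _ 3]) (auto simp: arc)
    next
      case 2
      then show ?thesis using n by (intro bexI[of _ 1] bexI[of _ 5]) (auto simp: arc)
    qed
  qed
  have fort3: "fort G {1, 2}"
    using n by (intro fortI) (auto simp: arc)
  have pd: "w = 0 \<or> w = 4" if w: "power_dominating G {w}" for w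
  proof (rule ccontr)
    assume "\<not> (w = 0 \<or> w = 4)"
    then consider "w = 1" | "w = 2" | "w = 3 \<or> 5 \<le> w" by linarith
    then show False
    proof cases
      case 1
      show False
        by (rule notE[OF not_power_dominating_fort[OF fin fort1, of _ 2] w])
           (use 1 n in \<open>auto simp: closed_nbhd_singleton arc V\<close>)
    next
      case 2
      show False
        by (rule notE[OF not_power_dominating_fort[OF fin fort2, of _ 1] w])
           (use 2 n in \<open>auto simp: closed_nbhd_singleton arc V\<close>)
    next
      case 3
      show False
        by (rule notE[OF not_power_dominating_fort[OF fin fort3, of _ 1] w])
           (use 3 n in \<open>auto simp: closed_nbhd_singleton arc V\<close>)
    qed
  qed
  show ?thesis
    unfolding G_def[symmetric]
  proof (rule rad_p_eqI)
    show "power_dominating G {0}"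
      using rad0(2) n V by (auto simp: power_dominating_def)
    show "rad_p_set G {w} = n - 3" if "power_dominating G {w}" for w
      using pd[OF that] rad0(1) rad4 by auto
  qed (use V n in \<open>auto simp: lessThan_empty_iff\<close>)
qed

lemma min_degree_square_strip:
  assumes n: "n \<ge> 8"
  shows "min_degree (nat_graph n square_strip_edge) = 2"
proof -
  define G where "G = nat_graph n square_strip_edge"
  note arc = parcs_nat_graph[of _ _ n square_strip_edge, folded G_def] square_strip_edge_def
  have fin: "finite (parcs G)" and V: "pverts G = {..<n}"
    by (simp_all add: G_def finite_parcs_nat_graph)
  have "min_degree G = 2"
  proof (rule min_degree_eqI[where v = 1])
    have "{w. (1, w) \<in> parcs G} = {0, 4}"
      using n by (auto simp: arc)
    then show "card {w. (1, w) \<in> parcs G} = 2" by simp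
    fix v assume "v \<in> pverts G"
    then have "v < n" using V by simp
    \<comment> \<open>Two preceding labels serve as neighbours only from \<open>7\<close> on, since
      \<open>4\<close> is not on the squared path.\<close>
    consider "v = 0" | "v = 1 \<or> v = 2" | "v = 3" | "v = 4" | "v = 5" | "v = 6" | "7 \<le> v"
      by linarith
    then show "\<exists>A. card A = 2 \<and> A \<subseteq> {w. (v, w) \<in> parcs G}"
    proof cases
      case 1
      then show ?thesis using n by (intro exI[of _ "{1, 2}"]) (auto simp: arc)
    next
      case 2
      then show ?thesis using n by (intro exI[of _ "{0, 4}"]) (auto simp: arc)
    next
      case 3
      then show ?thesis using n by (intro exI[of _ "{0, 5}"]) (auto simp: arc)
    next
      case 4
      then show ?thesis using n by (intro exI[of _ "{1, 2}"]) (auto simp: arc)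
    next
      case 5
      then show ?thesis using n by (intro exI[of _ "{3, 4}"]) (auto simp: arc)
    next
      case 6
      then show ?thesis using n by (intro exI[of _ "{3, 5}"]) (auto simp: arc)
    next
      case 7
      then show ?thesis using n \<open>v < n\<close>
        by (intro exI[of _ "{v - 2, v - 1}"]) (auto simp: arc)
    qed
  qed (use V fin n in auto)
  then show ?thesis by (simp add: G_def)
qed

section \<open>The infinite family for each minimum degree\<close>

theorem theorem3p5:
  fixes \<delta> :: nat
  assumes "\<delta> \<ge> 2"
  shows "\<exists>\<G> :: nat pair_pre_digraph set.
           infinite \<G> \<and>
           (\<forall>G\<in>\<G>. \<forall>H\<in>\<G>. G \<noteq> H \<longrightarrow> \<not> digraph_iso (with_proj G) (with_proj H)) \<and>
           (\<forall>G\<in>\<G>. pair_graph G \<and> pverts G \<noteq> {} \<and> min_degree G = \<delta> \<and>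
                  int (rad_p G) = int (card (pverts G)) - int \<delta> - 1)"
proof -
  define E where "E = (if \<delta> = 2 then square_strip_edge else twin_strip_edge \<delta>)"
  define f where "f n = nat_graph n E" for n
  \<comment> \<open>For \<open>\<delta> = 2\<close> the threshold is 8, so it suits both
    constructions. Distinct members have distinct orders, which gives infinity and
    non-isomorphism.\<close>
  define \<G> where "\<G> = f ` {2 * \<delta> + 4..}"
  have card_f: "card (pverts (f n)) = n" for n by (simp add: f_def)
  have "inj f" by (rule injI) (metis card_f)
  then have inf: "infinite \<G>"
    unfolding \<G>_def using finite_imageD[of f] infinite_Ici inj_on_subset by blast
  have iso: "\<not> digraph_iso (with_proj G) (with_proj H)" if "G \<in> \<G>" "H \<in> \<G>" "G \<noteq> H" for G H
    using that digraph_iso_card_verts[of "with_proj G" "with_proj H"]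
    by (auto simp: \<G>_def card_f)
  have props: "pair_graph G \<and> pverts G \<noteq> {} \<and> min_degree G = \<delta> \<and>
      int (rad_p G) = int (card (pverts G)) - int \<delta> - 1" if "G \<in> \<G>" for G
  proof -
    from that obtain n where n: "n \<ge> 2 * \<delta> + 4" "G = f n" by (auto simp: \<G>_def)
    have "min_degree G = \<delta> \<and> rad_p G = n - \<delta> - 1"
    proof (cases "\<delta> = 2")
      case True
      then show ?thesis
        using n rad_p_square_strip[of n] min_degree_square_strip[of n] by (simp add: f_def E_def)
    next
      case False
      then show ?thesis
        using n assms rad_p_twin_strip[of \<delta> n] min_degree_twin_strip[of \<delta> n]
        by (simp add: f_def E_def)
    qed
    \<comment> \<open>Since \<open>n\<close> exceeds \<open>\<delta>\<close>, the truncated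
      difference equals the integer one.\<close>
    then show ?thesis
      using n by (auto simp: card_f pair_graph_nat_graph f_def lessThan_empty_iff)
  qed
  show ?thesis
    using inf iso props by (intro exI[of _ \<G>] conjI ballI impI) simp_all
qed

end
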